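(* Let $D^n_k:=|\{i\in\{1,2,\dots,k\}: L_i=n\}|$ be the number of times up to $k$ at which the $n$-detachment process is in a state of detachment, and let $\mathsf{R}^n_k:=D^n_k/k$. If $k=k(n)=o(n^2)$ as $n\to\infty$ (with $k(n)$ positive integers), then $\lim_{n\to\infty}\mathsf{R}^n_{k(n)}=0$ in probability (even in $L^1$).
   Context: The $n$-detachment process ($n\ge1$): there are $n$ labeled passengers. At time $1$ all passengers sit in bus number $1$. At each integer time $k\ge 2$, a new bus with number $k$ becomes available and each passenger (currently sitting in one of the buses $1,\dots,k-1$), independently of the others and of the past, relocates to bus $k$ with probability $1/k$ and otherwise stays where they are. A passenger is lonely at time $k$ if no other passenger is in the same bus at time $k$; $L_k$ denotes the number of lonely passengers at time $k$. The process is in a state of detachment at time $k$ if $L_k=n$. *)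

theory Defs
  imports "HOL-Probability.Probability" "HOL-Library.Landau_Symbols"
begin

text \<open>
  The \<open>n\<close>-detachment process: \<open>bus k i \<omega>\<close> is the number of the bus in which passenger
  \<open>i \<in> {1..n}\<close> sits at time \<open>k \<ge> 1\<close>. Bus \<open>k\<close> is new at time \<open>k\<close>, so \<open>bus k i \<omega> = k\<close> says
  precisely that passenger \<open>i\<close> relocates at time \<open>k\<close>; the relocation events are mutually
  independent over all times \<open>k \<ge> 2\<close> and all passengers, which expresses that each passenger
  relocates independently of the others and of the past.
\<close>

locale detachment_process = prob_space M
  for M :: "'a measure" and n :: nat and bus :: "nat \<Rightarrow> nat \<Rightarrow> 'a \<Rightarrow> nat" +
  assumes n_pos: "n \<ge> 1"
    and bus_measurable:
      "k \<ge> 1 \<Longrightarrow> i \<in> {1..n} \<Longrightarrow> random_variable (count_space UNIV) (bus k i)"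
    and bus_start: "i \<in> {1..n} \<Longrightarrow> \<omega> \<in> space M \<Longrightarrow> bus 1 i \<omega> = 1"
    and bus_step: "k \<ge> 2 \<Longrightarrow> i \<in> {1..n} \<Longrightarrow> \<omega> \<in> space M \<Longrightarrow>
      bus k i \<omega> = k \<or> bus k i \<omega> = bus (k - 1) i \<omega>"
    and relocate_prob: "k \<ge> 2 \<Longrightarrow> i \<in> {1..n} \<Longrightarrow>
      prob {\<omega> \<in> space M. bus k i \<omega> = k} = 1 / real k"
    and relocate_indep:
      "indep_events (\<lambda>(k, i). {\<omega> \<in> space M. bus k i \<omega> = k}) ({2..} \<times> {1..n})"

definition lonely :: "nat \<Rightarrow> (nat \<Rightarrow> nat \<Rightarrow> 'a \<Rightarrow> nat) \<Rightarrow> nat \<Rightarrow> 'a \<Rightarrow> nat \<Rightarrow> bool" where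
  "lonely n bus k \<omega> i \<longleftrightarrow> (\<forall>j\<in>{1..n}. j \<noteq> i \<longrightarrow> bus k j \<omega> \<noteq> bus k i \<omega>)"

definition num_lonely :: "nat \<Rightarrow> (nat \<Rightarrow> nat \<Rightarrow> 'a \<Rightarrow> nat) \<Rightarrow> nat \<Rightarrow> 'a \<Rightarrow> nat" where
  "num_lonely n bus k \<omega> = card {i \<in> {1..n}. lonely n bus k \<omega> i}"

definition num_detached :: "nat \<Rightarrow> (nat \<Rightarrow> nat \<Rightarrow> 'a \<Rightarrow> nat) \<Rightarrow> nat \<Rightarrow> 'a \<Rightarrow> nat" where
  "num_detached n bus k \<omega> = card {i \<in> {1..k}. num_lonely n bus i \<omega> = n}"

definition detached_ratio :: "nat \<Rightarrow> (nat \<Rightarrow> nat \<Rightarrow> 'a \<Rightarrow> nat) \<Rightarrow> nat \<Rightarrow> 'a \<Rightarrow> real" where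
  "detached_ratio n bus k \<omega> = real (num_detached n bus k \<omega>) / real k"

text \<open>
  The locale is inhabited for every \<open>n \<ge> 1\<close>: take independent coins \<open>\<omega> (k, i)\<close> with success
  probability \<open>1 / k\<close>.
\<close>

primrec coin_bus :: "nat \<Rightarrow> nat \<Rightarrow> (nat \<times> nat \<Rightarrow> bool) \<Rightarrow> nat" where
  "coin_bus 0 i \<omega> = 1"
| "coin_bus (Suc k) i \<omega> = (if k \<ge> 1 \<and> \<omega> (Suc k, i) then Suc k else coin_bus k i \<omega>)"

definition coin_space :: "(nat \<times> nat \<Rightarrow> bool) measure" where
  "coin_space = PiM UNIV (\<lambda>(k, i). measure_pmf (bernoulli_pmf (1 / real k)))"

lemma coin_bus_le: "coin_bus k i \<omega> \<le> max 1 k"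
  by (induction k) auto

lemma coin_bus_eq_iff: "k \<ge> 2 \<Longrightarrow> coin_bus k i \<omega> = k \<longleftrightarrow> \<omega> (k, i)"
  using coin_bus_le[of "k - 1" i \<omega>] by (cases k) auto

lemma detachment_process_exists:
  assumes "n \<ge> 1"
  shows "detachment_process coin_space n coin_bus"
proof -
  define N :: "nat \<times> nat \<Rightarrow> bool measure"
    where "N = (\<lambda>(k, i). measure_pmf (bernoulli_pmf (1 / real k)))"
  have N: "prob_space (N x)" for x
    unfolding N_def by (cases x) (simp add: measure_pmf.prob_space_axioms)
  interpret P: product_prob_space N UNIV
    using N by (auto intro!: product_prob_spaceI)
  have cs: "coin_space = PiM UNIV N"
    unfolding coin_space_def N_def ..
  interpret prob_space coin_space
    unfolding cs by (rule P.prob_space_axioms)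
  have spN: "space (N x) = UNIV" and setsN: "sets (N x) = UNIV" for x
    unfolding N_def by (cases x; simp)+
  have sp: "space coin_space = UNIV"
    by (simp add: cs space_PiM spN)
  have coin: "(\<lambda>\<omega>. \<omega> x) \<in> measurable coin_space (count_space UNIV)" for x
  proof -
    have "(\<lambda>\<omega>. \<omega> x) \<in> measurable coin_space (N x)"
      unfolding cs by (rule measurable_component_singleton) simp
    then show ?thesis
      by (simp cong: measurable_cong_sets add: measurable_def spN setsN)
  qed
  have meas: "coin_bus k i \<in> measurable coin_space (count_space UNIV)" for k i
  proof (induction k)
    case 0
    then show ?case by simp
  next
    case (Suc k)
    note [measurable] = Suc coin
    have "(\<lambda>\<omega>. if k \<ge> 1 \<and> \<omega> (Suc k, i) then Suc k else coin_bus k i \<omega>)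
      \<in> measurable coin_space (count_space UNIV)"
      by measurable
    then show ?case by simp
  qed
  have joint: "prob {\<omega> \<in> space coin_space. \<forall>x\<in>J. \<omega> x} = (\<Prod>x\<in>J. 1 / real (fst x))"
    if J: "finite J" "J \<subseteq> {2..} \<times> {1..n}" for J :: "(nat \<times> nat) set"
  proof -
    have "{\<omega> \<in> space coin_space. \<forall>x\<in>J. \<omega> x} = prod_emb UNIV N J (Pi\<^sub>E J (\<lambda>_. {True}))"
      by (rule set_eqI) (unfold prod_emb_def Int_iff vimage_eq PiE_iff, auto simp: sp spN)
    also have "prob \<dots> = (\<Prod>x\<in>J. measure (N x) {True})"
      unfolding cs using J by (intro P.measure_PiM_emb) (auto simp: setsN)
    also have "\<dots> = (\<Prod>x\<in>J. 1 / real (fst x))"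
      using J(2) by (intro prod.cong) (auto simp: N_def measure_pmf_single field_simps)
    finally show ?thesis .
  qed
  let ?A = "\<lambda>(k, i). {\<omega> \<in> space coin_space. coin_bus k i \<omega> = k}"
  have A: "?A x = {\<omega> \<in> space coin_space. \<omega> x}" if "x \<in> {2..} \<times> {1..n}" for x
    using that by (auto simp: coin_bus_eq_iff)
  have pA: "prob (?A x) = 1 / real (fst x)" if "x \<in> {2..} \<times> {1..n}" for x
    using joint[of "{x}"] A[OF that] that by simp
  have indep: "indep_events ?A ({2..} \<times> {1..n})"
  proof (rule indep_eventsI)
    fix x :: "nat \<times> nat"
    show "?A x \<in> events"
      using meas[of "fst x" "snd x"] by (cases x) (auto intro!: measurable_sets_Collect simp: pred_def)
  next
    fix J :: "(nat \<times> nat) set" assume J: "J \<subseteq> {2..} \<times> {1..n}" "finite J" "J \<noteq> {}"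
    have "(\<Inter>x\<in>J. ?A x) = (\<Inter>x\<in>J. {\<omega> \<in> space coin_space. \<omega> x})"
      using J A by (intro INF_cong) auto
    also have "\<dots> = {\<omega> \<in> space coin_space. \<forall>x\<in>J. \<omega> x}"
      using J by auto
    also have "prob \<dots> = (\<Prod>x\<in>J. prob (?A x))"
      unfolding joint[OF J(2,1)] using J pA by (intro prod.cong) auto
    finally show "prob (\<Inter>x\<in>J. ?A x) = (\<Prod>x\<in>J. prob (?A x))" .
  qed
  show ?thesis
  proof
    fix k i :: nat assume "2 \<le> k" "i \<in> {1..n}"
    then show "prob {\<omega> \<in> space coin_space. coin_bus k i \<omega> = k} = 1 / real k"
      using pA[of "(k, i)"] by simp
  next
    fix k i :: nat and \<omega> :: "nat \<times> nat \<Rightarrow> bool"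
    assume "2 \<le> k"
    then show "coin_bus k i \<omega> = k \<or> coin_bus k i \<omega> = coin_bus (k - 1) i \<omega>"
      by (cases k) auto
  qed (use assms meas indep in auto)
qed

end

theory Submission
  imports Defs
begin

text \<open>
  At time \<open>k\<close> the \<open>n\<close> passengers are independently and uniformly distributed over the buses
  \<open>1,\<dots>,k\<close>, so detachment at time \<open>k\<close> has the birthday probability
  \<open>\<Prod>j<n. (1 - j/k) \<le> exp (- n(n-1)/(2k)) \<le> 2k / (n(n-1))\<close>. This bound increases with \<open>k\<close>, hence it
  also bounds the expected proportion of detachment times up to \<open>k\<close>, and it vanishes
  if \<open>k = o(n\<^sup>2)\<close>. Markov's inequality turns this into convergence in probability.
\<close>

section \<open>Detachment as injectivity of the seating, and the birthday bound\<close>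

lemma num_lonely_eq_iff_inj_on:
  "num_lonely n bus k \<omega> = n \<longleftrightarrow> inj_on (\<lambda>i. bus k i \<omega>) {1..n}"
proof -
  have "num_lonely n bus k \<omega> = n \<longleftrightarrow> {i \<in> {1..n}. lonely n bus k \<omega> i} = {1..n}"
  proof
    assume "num_lonely n bus k \<omega> = n"
    then show "{i \<in> {1..n}. lonely n bus k \<omega> i} = {1..n}"
      unfolding num_lonely_def by (intro card_subset_eq) auto
  qed (simp add: num_lonely_def)
  also have "\<dots> \<longleftrightarrow> inj_on (\<lambda>i. bus k i \<omega>) {1..n}"
    unfolding lonely_def inj_on_def by blast
  finally show ?thesis .
qed

text \<open>Telescopes, since each factor is (j - 1)/j. It is the chance that a passenger sitting in
  a bus at time \<open>m\<close> never relocates during times m+1,...,k.\<close>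

lemma prod_one_minus_inverse:
  assumes "1 \<le> m" "m \<le> k"
  shows "(\<Prod>j\<in>{Suc m..k}. 1 - 1 / real j) = real m / real k"
  using assms(2)
proof (induction k rule: dec_induct)
  case (step k)
  then show ?case
    using assms(1) by (simp add: field_simps)
qed (use assms in simp)

lemma birthday_count_le:
  assumes "k \<ge> 1" "n \<ge> 2"
  shows "real (card {f \<in> {1..n} \<rightarrow>\<^sub>E {1..k}. inj_on f {1..n}}) / real k ^ n
    \<le> 4 * real k / real n ^ 2"
proof -
  have "real (card {f \<in> {1..n} \<rightarrow>\<^sub>E {1..k}. inj_on f {1..n}}) / real k ^ n
      = (\<Prod>j<n. real (k - j) / real k)"
    using card_inj_on_subset_funcset[of "{1..n}" "{1..k}" "{1..n}"]
    by (simp add: prod_dividef atLeast0LessThan)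
  also have "\<dots> \<le> (\<Prod>j<n. exp (- (real j / real k)))"
  proof (intro prod_mono conjI)
    fix j
    have "1 - real j / real k \<le> exp (- (real j / real k))"
      using exp_ge_add_one_self[of "- (real j / real k)"] by simp
    \<comment> \<open>For j > k the natural-number difference \<open>k - j\<close> is 0, so the
      bound also holds where 1 - j/k would be negative.\<close>
    then show "real (k - j) / real k \<le> exp (- (real j / real k))"
      using \<open>k \<ge> 1\<close> by (cases "j \<le> k") (simp_all add: of_nat_diff diff_divide_distrib)
  qed simp
  also have "\<dots> = exp (- ((\<Sum>j<n. real j) / real k))"
    by (simp flip: exp_sum add: sum_negf sum_divide_distrib)
  also have "(\<Sum>j<n. real j) = real n * (real n - 1) / 2"
    by (induction n) (simp_all add: field_simps)
  \<comment> \<open>The constant 4 arises here: n - 1 \<ge> n/2 because n \<ge> 2.\<close>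
  also have "exp (- (real n * (real n - 1) / 2 / real k)) \<le> exp (- (real n ^ 2 / (4 * real k)))"
    using assms by (simp add: field_simps power2_eq_square)
  \<comment> \<open>For x > 0, exp(-x) \<le> 1/x, because x \<le> exp x.\<close>
  also have "\<dots> \<le> inverse (real n ^ 2 / (4 * real k))"
  proof -
    have "real n ^ 2 / (4 * real k) \<le> exp (real n ^ 2 / (4 * real k))"
      using exp_ge_add_one_self[of "real n ^ 2 / (4 * real k)"] by linarith
    then show ?thesis
      unfolding exp_minus using assms by (intro le_imp_inverse_le) simp_all
  qed
  finally show ?thesis
    by simp
qed

context detachment_process
begin

section \<open>Law of the seating at a fixed time\<close>

lemma bus_range:
  assumes "k \<ge> 1" "i \<in> {1..n}" "\<omega> \<in> space M"
  shows "bus k i \<omega> \<in> {1..k}"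
  using assms(1)
proof (induction k rule: dec_induct)
  case (step k)
  then show ?case
    using bus_step[of "Suc k" i \<omega>] assms by auto
qed (use bus_start assms in simp)

text \<open>The current bus carries the number of the last relocation time, or 1 if there was none.
  Hence sitting in \<open>m\<close> means relocating at time \<open>m\<close> and never since. The
  range starts at \<open>max 2 m\<close> because nobody relocates at time 1; for m = 1 it only
  demands staying put.\<close>

lemma bus_eq_iff_relocations:
  assumes "k \<ge> 1" "i \<in> {1..n}" "\<omega> \<in> space M" "m \<in> {1..k}"
  shows "bus k i \<omega> = m \<longleftrightarrow> (\<forall>j\<in>{max 2 m..k}. bus j i \<omega> = j \<longleftrightarrow> j = m)"
  using assms(1,4)
proof (induction k arbitrary: m rule: dec_induct)
  case base
  then show ?case using bus_start assms by simp
next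
  case (step k)
  show ?case
  proof (cases "m = Suc k")
    case True
    then show ?thesis using step.hyps by (auto simp: max_def)
  next
    case False
    then have m: "m \<in> {1..k}"
      using step.prems by auto
    then have set: "{max 2 m..Suc k} = insert (Suc k) {max 2 m..k}"
      using step.hyps by auto
    have bs: "bus (Suc k) i \<omega> = Suc k \<or> bus (Suc k) i \<omega> = bus k i \<omega>"
      using bus_step[of "Suc k" i \<omega>] step.hyps assms by simp
    have "bus k i \<omega> \<in> {1..k}"
      using bus_range step.hyps assms by simp
    then have "bus (Suc k) i \<omega> = m \<longleftrightarrow> bus (Suc k) i \<omega> \<noteq> Suc k \<and> bus k i \<omega> = m"
      using bs False by auto
    then show ?thesis
      unfolding set using step.IH[OF m] False by auto
  qed
qed

text \<open>All seatings are equally likely: a seating prescribes the outcome of independent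
  relocation events, and each passenger sent to bus m contributes (1/m) * (m/k) = 1/k.\<close>

lemma prob_bus_eq:
  assumes k: "k \<ge> 1" and f: "f \<in> {1..n} \<rightarrow> {1..k}"
  shows "prob {\<omega> \<in> space M. \<forall>i\<in>{1..n}. bus k i \<omega> = f i} = 1 / real k ^ n"
proof (cases "k = 1")
  \<comment> \<open>For k = 1 the index set \<open>J\<close> used below would be empty; here
    everybody sits in bus 1.\<close>
  case True
  then have "{\<omega> \<in> space M. \<forall>i\<in>{1..n}. bus k i \<omega> = f i} = space M"
    using f bus_start by (fastforce simp: Pi_iff)
  then show ?thesis
    using True prob_space by simp
next
  case False
  define A where "A = (\<lambda>(j, i). {\<omega> \<in> space M. bus j i \<omega> = j})"
  \<comment> \<open>\<open>B (i, j)\<close> is what \<open>f\<close> demands of passenger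
    \<open>i\<close> at time \<open>j\<close>, and \<open>J\<close> collects the pairs where it
    demands something.\<close>
  define B where "B = (\<lambda>(i, j). if j = f i then A (j, i) else space M - A (j, i))"
  define J where "J = (SIGMA i:{1..n}. {max 2 (f i)..k})"
  have fin: "finite J"
    by (simp add: J_def)
  have "(1, k) \<in> J"
    using False k f n_pos by (auto simp: J_def Pi_iff)
  then have ne: "J \<noteq> {}"
    by blast
  \<comment> \<open>Complements of relocation events occur too, so independence is lifted to the
    sigma-algebras generated by the single events.\<close>
  have ind: "indep_sets (\<lambda>x. sigma_sets (space M) {A x}) ({2..} \<times> {1..n})"
    using relocate_indep unfolding indep_events_def_alt A_def
    by (rule indep_sets_sigma) (simp add: Int_stable_def)
  have A_ev: "A (j, i) \<in> events" if "j \<ge> 2" "i \<in> {1..n}" for i j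
  proof -
    have [measurable]: "bus j i \<in> measurable M (count_space UNIV)"
      using bus_measurable that by simp
    show ?thesis
      unfolding A_def by simp
  qed
  have B_sigma: "B (i, j) \<in> sigma_sets (space M) {A (j, i)}" for i j
    by (auto simp: B_def intro: sigma_sets.Basic sigma_sets.Compl)
  have B_prob: "prob (B (i, j)) = (if j = f i then 1 / real j else 1 - 1 / real j)"
    if "(i, j) \<in> J" for i j
  proof -
    have ij: "j \<ge> 2" "i \<in> {1..n}"
      using that by (auto simp: J_def)
    then have "prob (A (j, i)) = 1 / real j"
      using relocate_prob by (simp add: A_def)
    then show ?thesis
      using prob_compl[OF A_ev[OF ij]] by (cases "j = f i") (simp_all add: B_def)
  qed
  have "{\<omega> \<in> space M. \<forall>i\<in>{1..n}. bus k i \<omega> = f i} = (\<Inter>x\<in>J. B x)"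
  proof (intro set_eqI iffI)
    fix \<omega> assume *: "\<omega> \<in> {\<omega> \<in> space M. \<forall>i\<in>{1..n}. bus k i \<omega> = f i}"
    have "\<omega> \<in> B (i, j)" if "(i, j) \<in> J" for i j
    proof -
      have i: "i \<in> {1..n}" "j \<in> {max 2 (f i)..k}"
        using that by (auto simp: J_def)
      then have "bus j i \<omega> = j \<longleftrightarrow> j = f i"
        using * bus_eq_iff_relocations[of k i \<omega> "f i"] k f by (auto simp: Pi_iff)
      then show ?thesis
        using * by (auto simp: B_def A_def)
    qed
    then show "\<omega> \<in> (\<Inter>x\<in>J. B x)"
      by auto
  next
    fix \<omega> assume *: "\<omega> \<in> (\<Inter>x\<in>J. B x)"
    \<comment> \<open>An intersection over an empty index set would be everything, so
      \<open>ne\<close> matters here.\<close>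
    then have sp: "\<omega> \<in> space M"
      using ne by (fastforce simp: B_def A_def split: if_splits)
    have "bus k i \<omega> = f i" if i: "i \<in> {1..n}" for i
    proof -
      have "bus j i \<omega> = j \<longleftrightarrow> j = f i" if "j \<in> {max 2 (f i)..k}" for j
      proof -
        have "(i, j) \<in> J"
          using i that by (simp add: J_def)
        then have "\<omega> \<in> B (i, j)"
          using * by blast
        then show ?thesis
          using sp by (auto simp: B_def A_def split: if_splits)
      qed
      then show ?thesis
        using bus_eq_iff_relocations[of k i \<omega> "f i"] i sp k f by (auto simp: Pi_iff)
    qed
    then show "\<omega> \<in> {\<omega> \<in> space M. \<forall>i\<in>{1..n}. bus k i \<omega> = f i}"
      using sp by simp
  qed
  \<comment> \<open>Independence is indexed by (time, passenger), whereas \<open>J\<close> lists the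
    passenger first so that the product later splits by passenger.\<close>
  also have "\<dots> = (\<Inter>x\<in>prod.swap ` J. B (prod.swap x))"
    by (simp add: image_comp)
  also have "prob \<dots> = (\<Prod>x\<in>prod.swap ` J. prob (B (prod.swap x)))"
    using fin ne B_sigma by (intro indep_setsD[OF ind]) (auto simp: J_def)
  also have "\<dots> = (\<Prod>x\<in>J. prob (B x))"
    by (subst prod.reindex) (auto simp: inj_on_def)
  also have "\<dots> = (\<Prod>(i, j)\<in>J. if j = f i then 1 / real j else 1 - 1 / real j)"
    using B_prob by (intro prod.cong) auto
  also have "\<dots> = (\<Prod>i\<in>{1..n}. \<Prod>j\<in>{max 2 (f i)..k}. if j = f i then 1 / real j else 1 - 1 / real j)"
    unfolding J_def by (subst prod.Sigma) auto
  also have "\<dots> = (\<Prod>i\<in>{1..n}. 1 / real k)"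
  proof (rule prod.cong[OF refl])
    fix i assume "i \<in> {1..n}"
    then have fi: "1 \<le> f i" "f i \<le> k"
      using f by (auto simp: Pi_iff)
    have "(\<Prod>j\<in>{Suc (f i)..k}. if j = f i then 1 / real j else 1 - 1 / real j)
        = (\<Prod>j\<in>{Suc (f i)..k}. 1 - 1 / real j)"
      by (intro prod.cong) auto
    also have "\<dots> = real (f i) / real k"
      using fi by (rule prod_one_minus_inverse)
    finally have tail: "(\<Prod>j\<in>{Suc (f i)..k}. if j = f i then 1 / real j else 1 - 1 / real j)
        = real (f i) / real k" .
    \<comment> \<open>If \<open>f i\<close> is 1, only factors for staying occur and
      \<open>tail\<close> is already 1/k. Otherwise the relocation factor 1 / \<open>f i\<close>
      cancels the numerator of \<open>tail\<close>.\<close>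
    show "(\<Prod>j\<in>{max 2 (f i)..k}. if j = f i then 1 / real j else 1 - 1 / real j) = 1 / real k"
    proof (cases "f i = 1")
      case True
      then show ?thesis
        using tail by (simp add: numeral_2_eq_2)
    next
      case False
      then have "{max 2 (f i)..k} = insert (f i) {Suc (f i)..k}"
        using fi by auto
      then show ?thesis
        using tail fi by simp
    qed
  qed
  finally show ?thesis
    by (simp add: power_one_over)
qed

section \<open>Probability of detachment at a fixed time\<close>

lemma bus_eq_event:
  assumes "k \<ge> 1"
  shows "{\<omega> \<in> space M. \<forall>i\<in>{1..n}. bus k i \<omega> = f i} \<in> events"
proof -
  have [measurable]: "bus k i \<in> measurable M (count_space UNIV)" if "i \<in> {1..n}" for i
    using bus_measurable assms that by simp
  show ?thesis
    by measurable
qed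

text \<open>Splits detachment by the seating that realises it. Taking extensional functions keeps
  the index set finite, which serves measurability and the union bound.\<close>

lemma detached_eq_Union:
  assumes "k \<ge> 1"
  shows "{\<omega> \<in> space M. num_lonely n bus k \<omega> = n}
    = (\<Union>f\<in>{f \<in> {1..n} \<rightarrow>\<^sub>E {1..k}. inj_on f {1..n}}.
        {\<omega> \<in> space M. \<forall>i\<in>{1..n}. bus k i \<omega> = f i})" (is "?L = ?R")
proof (intro set_eqI iffI)
  fix \<omega> assume \<omega>: "\<omega> \<in> ?L"
  let ?f = "restrict (\<lambda>i. bus k i \<omega>) {1..n}"
  have "?f \<in> {1..n} \<rightarrow>\<^sub>E {1..k}"
    using \<omega> bus_range assms by (auto simp: PiE_iff)
  moreover have "inj_on ?f {1..n}"
    using \<omega> by (simp add: num_lonely_eq_iff_inj_on inj_on_restrict_eq)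
  ultimately show "\<omega> \<in> ?R"
    using \<omega> by (intro UN_I[of ?f]) auto
next
  fix \<omega> assume "\<omega> \<in> ?R"
  then obtain f where "\<omega> \<in> space M" "inj_on f {1..n}" "\<forall>i\<in>{1..n}. bus k i \<omega> = f i"
    by blast
  then show "\<omega> \<in> ?L"
    using inj_on_cong[of "{1..n}" "\<lambda>i. bus k i \<omega>" f] by (simp add: num_lonely_eq_iff_inj_on)
qed

lemma finite_inj_PiE: "finite {f \<in> {1..n} \<rightarrow>\<^sub>E {1..k::nat}. inj_on f {1..n}}"
  by (intro finite_Collect_conjI disjI1) (simp add: finite_PiE)

lemma detached_event:
  assumes "k \<ge> 1"
  shows "{\<omega> \<in> space M. num_lonely n bus k \<omega> = n} \<in> events"
  unfolding detached_eq_Union[OF assms]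
  by (intro sets.finite_UN finite_inj_PiE bus_eq_event assms)

text \<open>Only an upper bound is wanted, so subadditivity over the injective seatings suffices;
  each has probability 1/k^n, and the birthday bound handles their number.\<close>

lemma prob_detached_le:
  assumes "k \<ge> 1" "n \<ge> 2"
  shows "prob {\<omega> \<in> space M. num_lonely n bus k \<omega> = n} \<le> 4 * real k / real n ^ 2"
proof -
  let ?F = "{f \<in> {1..n} \<rightarrow>\<^sub>E {1..k}. inj_on f {1..n}}"
  have "prob {\<omega> \<in> space M. num_lonely n bus k \<omega> = n}
      \<le> (\<Sum>f\<in>?F. prob {\<omega> \<in> space M. \<forall>i\<in>{1..n}. bus k i \<omega> = f i})"
    unfolding detached_eq_Union[OF assms(1)]
    by (intro measure_UNION_le finite_inj_PiE bus_eq_event assms)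
  also have "\<dots> = (\<Sum>f\<in>?F. 1 / real k ^ n)"
    by (intro sum.cong refl prob_bus_eq assms) (auto simp: PiE_iff)
  also have "\<dots> = real (card ?F) / real k ^ n"
    by simp
  also have "\<dots> \<le> 4 * real k / real n ^ 2"
    using assms by (rule birthday_count_le)
  finally show ?thesis .
qed

section \<open>Expected proportion of detachment times\<close>

lemma detached_ratio_eq_sum:
  assumes "\<omega> \<in> space M"
  shows "detached_ratio n bus k \<omega>
    = (\<Sum>i\<in>{1..k}. indicator {\<omega> \<in> space M. num_lonely n bus i \<omega> = n} \<omega>) / real k"
  using assms
  by (simp add: detached_ratio_def num_detached_def indicator_def sum.If_cases Int_def)

lemma integrable_indicator_detached:
  assumes "i \<in> {1..k}"
  shows "integrable M (indicator {\<omega> \<in> space M. num_lonely n bus i \<omega> = n} :: 'a \<Rightarrow> real)"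
  using detached_event[of i] assms by (simp add: less_top[symmetric])

lemma integrable_detached_ratio: "integrable M (detached_ratio n bus k)"
proof -
  have "integrable M (\<lambda>\<omega>. (\<Sum>i\<in>{1..k}.
      indicator {\<omega> \<in> space M. num_lonely n bus i \<omega> = n} \<omega>) / real k)"
    by (intro integrable_divide Bochner_Integration.integrable_sum integrable_indicator_detached)
  then show ?thesis
    by (simp cong: Bochner_Integration.integrable_cong add: detached_ratio_eq_sum)
qed

lemma expectation_detached_ratio_le:
  assumes "k \<ge> 1" "n \<ge> 2"
  shows "expectation (detached_ratio n bus k) \<le> 4 * real k / real n ^ 2"
proof -
  have "expectation (detached_ratio n bus k) = expectation (\<lambda>\<omega>. (\<Sum>i\<in>{1..k}.
      indicator {\<omega> \<in> space M. num_lonely n bus i \<omega> = n} \<omega>) / real k)"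
    by (intro Bochner_Integration.integral_cong refl detached_ratio_eq_sum)
  also have "\<dots> = (\<Sum>i\<in>{1..k}. prob {\<omega> \<in> space M. num_lonely n bus i \<omega> = n}) / real k"
    using integrable_indicator_detached[of _ k]
    by (subst integral_divide_zero, subst Bochner_Integration.integral_sum)
      (auto simp: Int_def conj_commute intro!: sum.cong arg_cong[where f = prob])
  also have "\<dots> \<le> (\<Sum>i\<in>{1..k}. 4 * real k / real n ^ 2) / real k"
  proof (intro divide_right_mono sum_mono)
    fix i assume i: "i \<in> {1..k}"
    then have "prob {\<omega> \<in> space M. num_lonely n bus i \<omega> = n} \<le> 4 * real i / real n ^ 2"
      using assms by (intro prob_detached_le) auto
    \<comment> \<open>The bound grows with time, so its value at time \<open>k\<close> dominates
      every summand and hence their average.\<close>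
    also have "\<dots> \<le> 4 * real k / real n ^ 2"
      using i by (intro divide_right_mono) auto
    finally show "prob {\<omega> \<in> space M. num_lonely n bus i \<omega> = n} \<le> 4 * real k / real n ^ 2" .
  qed simp
  also have "\<dots> = 4 * real k / real n ^ 2"
    using assms by simp
  finally show ?thesis .
qed

end

section \<open>Passage to the limit, first in mean and then in probability\<close>

theorem corollary2p3:
  fixes M :: "nat \<Rightarrow> 'a measure"
    and bus :: "nat \<Rightarrow> nat \<Rightarrow> nat \<Rightarrow> 'a \<Rightarrow> nat"
    and k :: "nat \<Rightarrow> nat"
  assumes process: "\<And>n. n \<ge> 1 \<Longrightarrow> detachment_process (M n) n (bus n)"
    and k_pos: "\<And>n. n \<ge> 1 \<Longrightarrow> k n \<ge> 1"
    and k_small: "(\<lambda>n. real (k n)) \<in> o(\<lambda>n. real n ^ 2)"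
  shows "(\<forall>\<epsilon>>0. (\<lambda>n. measure (M n)
              {\<omega> \<in> space (M n). \<bar>detached_ratio n (bus n) (k n) \<omega>\<bar> > \<epsilon>}) \<longlonglongrightarrow> 0)
       \<and> (\<forall>n\<ge>1. integrable (M n) (detached_ratio n (bus n) (k n)))
       \<and> (\<lambda>n. \<integral>\<omega>. \<bar>detached_ratio n (bus n) (k n) \<omega>\<bar> \<partial>M n) \<longlonglongrightarrow> 0"
proof (intro conjI allI impI)
  let ?R = "\<lambda>n. detached_ratio n (bus n) (k n)"
  let ?E = "\<lambda>n. \<integral>\<omega>. \<bar>?R n \<omega>\<bar> \<partial>M n"
  \<comment> \<open>The ratio is nonnegative, so its L1 norm is its expectation.\<close>
  have abs_R: "\<bar>?R n \<omega>\<bar> = ?R n \<omega>" for n \<omega>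
    by (simp add: detached_ratio_def)
  show int: "integrable (M n) (?R n)" if "n \<ge> 1" for n
    using process[OF that] by (rule detachment_process.integrable_detached_ratio)
  have "(\<lambda>n. real (k n) / real n ^ 2) \<longlonglongrightarrow> 0"
    using k_small by (rule smalloD_tendsto)
  then have lim: "(\<lambda>n. 4 * real (k n) / real n ^ 2) \<longlonglongrightarrow> 0"
    using tendsto_mult_left[of _ 0 sequentially 4] by fastforce
  show E_lim: "?E \<longlonglongrightarrow> 0"
  proof (rule tendsto_sandwich[OF _ _ tendsto_const lim])
    show "\<forall>\<^sub>F n in sequentially. ?E n \<le> 4 * real (k n) / real n ^ 2"
      using eventually_ge_at_top[of 2]
    proof eventually_elim
      case (elim n)
      then show ?case
        using detachment_process.expectation_detached_ratio_le[OF process k_pos, of n]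
        by (simp add: abs_R)
    qed
  qed simp
  fix \<epsilon> :: real assume \<epsilon>: "\<epsilon> > 0"
  have "(\<lambda>n. ?E n / \<epsilon>) \<longlonglongrightarrow> 0"
    using E_lim by (rule tendsto_divide_zero)
  then show "(\<lambda>n. measure (M n) {\<omega> \<in> space (M n). \<bar>?R n \<omega>\<bar> > \<epsilon>}) \<longlonglongrightarrow> 0"
  proof (rule tendsto_sandwich[OF _ _ tendsto_const, rotated -1])
    show "\<forall>\<^sub>F n in sequentially.
        measure (M n) {\<omega> \<in> space (M n). \<bar>?R n \<omega>\<bar> > \<epsilon>} \<le> ?E n / \<epsilon>"
      using eventually_ge_at_top[of 1]
    proof eventually_elim
      case (elim n)
      interpret detachment_process "M n" n "bus n"
        using elim by (rule process)
      note [measurable] = borel_measurable_integrable[OF int[OF elim]]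
      \<comment> \<open>Markov's inequality bounds the larger event with a non-strict
        inequality.\<close>
      have "prob {\<omega> \<in> space (M n). \<bar>?R n \<omega>\<bar> > \<epsilon>} \<le> prob {\<omega> \<in> space (M n). \<bar>?R n \<omega>\<bar> \<ge> \<epsilon>}"
        by (intro finite_measure_mono) auto
      also have "\<dots> \<le> ?E n / \<epsilon>"
        using int[OF elim] \<epsilon> by (intro integral_Markov_inequality_measure[of _ _ "{}"]) auto
      finally show ?case .
    qed
  qed simp
qed

end
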